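(* Let $1\le p<\infty$, let $d\ge 1$, let $\mathcal{X}$ be a reflexive Banach space and $\mathcal{Y}$ a Banach space over $\mathbb{F}$. Let $\mathcal{T}=(T_1,\dots,T_d)\in\mathcal{K}(\mathcal{X},\ell_p^d(\mathcal{Y}))$, where $\bigcap_{i=1}^d M_{T_i}\neq\emptyset$. If $T_i$ is smooth in $\mathcal{K}(\mathcal{X},\mathcal{Y})$ for each $1\le i\le d$, then $\mathcal{T}$ is smooth in $\mathcal{K}(\mathcal{X},\ell_p^d(\mathcal{Y}))$.
   Context: $\mathbb{F}$ is $\mathbb{R}$ or $\mathbb{C}$. $\ell_p^d(\mathcal{Y})$ is the direct sum of $d$ copies of $\mathcal{Y}$ with norm $\|(y_1,\dots,y_d)\|_p=(\sum_{i=1}^d\|y_i\|^p)^{1/p}$. $\mathcal{K}(\mathcal{X},\mathcal{Y})$ is the space of compact linear operators from $\mathcal{X}$ to $\mathcal{Y}$ with the operator norm. A tuple $\mathcal{T}=(T_1,\dots,T_d)$ with $T_k:\mathcal{X}\to\mathcal{Y}$ is identified with the operator $x\mapsto(T_1x,\dots,T_dx)$ into $\ell_p^d(\mathcal{Y})$, and $\|\mathcal{T}\|$ is its operator norm. $S_{\mathcal{X}}$ is the unit sphere of $\mathcal{X}$, and $M_T=\{x\in S_{\mathcal{X}}:\|Tx\|=\|T\|\}$ is the norm attainment set of an operator $T$ on $\mathcal{X}$. A nonzero element $x$ of a Banach space $\mathcal{Z}$ is smooth if $J(x)=\{f\in\mathcal{Z}^*:\|f\|=1,\ f(x)=\|x\|\}$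 is a singleton. *)

theory Defs
  imports "HOL-Analysis.Analysis" "HOL-Library.Function_Algebras"
begin

text \<open>
  The scalar field is the real or the complex numbers: a type of this class comes with an
  isometric field embedding into the complex numbers whose image is one of the two.
\<close>

class real_or_complex = real_normed_field +
  fixes to_complex :: "'a \<Rightarrow> complex"
  assumes to_complex_add: "to_complex (a + b) = to_complex a + to_complex b"
    and to_complex_mult: "to_complex (a * b) = to_complex a * to_complex b"
    and to_complex_scaleR: "to_complex (r *\<^sub>R a) = r *\<^sub>R to_complex a"
    and norm_to_complex: "norm (to_complex a) = norm a"
    and range_to_complex: "range to_complex = \<real> \<or> range to_complex = UNIV"

instantiation real :: real_or_complex
begin

definition to_complex_real :: "real \<Rightarrow> complex"
  where "to_complex_real = complex_of_real"

instance
  by standard (auto simp: to_complex_real_def Reals_def scaleR_conv_of_real)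

end

instantiation complex :: real_or_complex
begin

definition to_complex_complex :: "complex \<Rightarrow> complex"
  where "to_complex_complex = id"

instance
  by standard (auto simp: to_complex_complex_def)

end

text \<open>
  A normed space over such a field is a real normed space with a scalar multiplication
  extending the real one, for which the norm is homogeneous. A Banach space over the field is
  then one whose underlying type is in class \<open>banach\<close>.
\<close>

locale normed_space_over = vector_space scale
  for scale :: "'k::real_or_complex \<Rightarrow> 'a::real_normed_vector \<Rightarrow> 'a" +
  assumes scale_of_real: "scale (of_real r) x = r *\<^sub>R x"
    and norm_scale: "norm (scale c x) = norm c * norm x"

text \<open>
  The spaces built from these (duals, spaces of operators, $\ell_p$-sums) depend on the scalar
  multiplication or on \<open>p\<close>, so they are not types: they are given by a carrier set, a
  scalar multiplication and a norm. Addition is that of the ambient type; for functions it is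
  the pointwise one of \<^theory>\<open>HOL-Library.Function_Algebras\<close>.
\<close>

record ('k, 'a) nspace =
  carrier :: "'a set"
  smul :: "'k \<Rightarrow> 'a \<Rightarrow> 'a"
  nrm :: "'a \<Rightarrow> real"

definition type_space :: "('k \<Rightarrow> 'a \<Rightarrow> 'a) \<Rightarrow> ('k, 'a::real_normed_vector) nspace"
  where "type_space s = \<lparr>carrier = UNIV, smul = s, nrm = norm\<rparr>"

definition scalar_space :: "('k, 'k::real_or_complex) nspace"
  where "scalar_space = type_space (*)"

definition norm_topology :: "('k, 'a::ab_group_add) nspace \<Rightarrow> 'a topology"
  where "norm_topology V = Metric_space.mtopology (carrier V) (\<lambda>x y. nrm V (x - y))"

definition unit_ball :: "('k, 'a) nspace \<Rightarrow> 'a set"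
  where "unit_ball V = {x \<in> carrier V. nrm V x \<le> 1}"

definition unit_sphere :: "('k, 'a) nspace \<Rightarrow> 'a set"
  where "unit_sphere V = {x \<in> carrier V. nrm V x = 1}"

text \<open>
  Operators are total functions vanishing off the carrier, so that two operators agreeing on
  the carrier are equal.
\<close>

definition linear_maps ::
    "('k, 'a::ab_group_add) nspace \<Rightarrow> ('k, 'b::ab_group_add) nspace \<Rightarrow> ('a \<Rightarrow> 'b) set"
  where "linear_maps V W = {T.
    (\<forall>x\<in>carrier V. T x \<in> carrier W) \<and>
    (\<forall>x. x \<notin> carrier V \<longrightarrow> T x = 0) \<and>
    (\<forall>x\<in>carrier V. \<forall>y\<in>carrier V. T (x + y) = T x + T y) \<and>
    (\<forall>c. \<forall>x\<in>carrier V. T (smul V c x) = smul W c (T x))}"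

definition op_norm :: "('k, 'a) nspace \<Rightarrow> ('k, 'b) nspace \<Rightarrow> ('a \<Rightarrow> 'b) \<Rightarrow> real"
  where "op_norm V W T = (SUP x\<in>unit_ball V. nrm W (T x))"

definition bounded_operators ::
    "('k, 'a::ab_group_add) nspace \<Rightarrow> ('k, 'b::ab_group_add) nspace \<Rightarrow> ('k, 'a \<Rightarrow> 'b) nspace"
  where "bounded_operators V W =
    \<lparr>carrier = {T \<in> linear_maps V W. \<exists>C. \<forall>x\<in>carrier V. nrm W (T x) \<le> C * nrm V x},
     smul = (\<lambda>c T x. smul W c (T x)),
     nrm = op_norm V W\<rparr>"

definition compact_operators ::
    "('k, 'a::ab_group_add) nspace \<Rightarrow> ('k, 'b::ab_group_add) nspace \<Rightarrow> ('k, 'a \<Rightarrow> 'b) nspace"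
  where "compact_operators V W =
    \<lparr>carrier = {T \<in> linear_maps V W.
       compactin (norm_topology W) (norm_topology W closure_of (T ` unit_ball V))},
     smul = (\<lambda>c T x. smul W c (T x)),
     nrm = op_norm V W\<rparr>"

definition dual :: "('k::real_or_complex, 'a::ab_group_add) nspace \<Rightarrow> ('k, 'a \<Rightarrow> 'k) nspace"
  where "dual V = bounded_operators V scalar_space"

definition bidual_embedding ::
    "('k::real_or_complex, 'a::ab_group_add) nspace \<Rightarrow> 'a \<Rightarrow> ('a \<Rightarrow> 'k) \<Rightarrow> 'k"
  where "bidual_embedding V x = (\<lambda>f. if f \<in> carrier (dual V) then f x else 0)"

definition reflexive :: "('k::real_or_complex, 'a::ab_group_add) nspace \<Rightarrow> bool"
  where "reflexive V \<longleftrightarrow> bidual_embedding V ` carrier V = carrier (dual (dual V))"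

definition support_functionals ::
    "('k::real_or_complex, 'a::ab_group_add) nspace \<Rightarrow> 'a \<Rightarrow> ('a \<Rightarrow> 'k) set"
  where "support_functionals V x =
    {f \<in> carrier (dual V). nrm (dual V) f = 1 \<and> f x = of_real (nrm V x)}"

definition smooth :: "('k::real_or_complex, 'a::ab_group_add) nspace \<Rightarrow> 'a \<Rightarrow> bool"
  where "smooth V x \<longleftrightarrow> x \<in> carrier V \<and> x \<noteq> 0 \<and> is_singleton (support_functionals V x)"

definition norm_attainment_set ::
    "('k, 'a) nspace \<Rightarrow> ('k, 'b) nspace \<Rightarrow> ('a \<Rightarrow> 'b) \<Rightarrow> 'a set"
  where "norm_attainment_set V W T = {x \<in> unit_sphere V. nrm W (T x) = op_norm V W T}"

text \<open>
  The number of summands is the cardinality of the finite index type \<open>'d\<close>. The type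
  \<open>'a ^ 'd\<close> only supplies the vector addition; its library norm is not used.
\<close>

definition lp_sum :: "real \<Rightarrow> ('k, 'a) nspace \<Rightarrow> ('k, 'a ^ 'd::finite) nspace"
  where "lp_sum p V =
    \<lparr>carrier = {y. \<forall>i. y $ i \<in> carrier V},
     smul = (\<lambda>c y. \<chi> i. smul V c (y $ i)),
     nrm = (\<lambda>y. (\<Sum>i\<in>UNIV. nrm V (y $ i) powr p) powr (1 / p))\<rparr>"

definition operator_tuple :: "('d::finite \<Rightarrow> 'a \<Rightarrow> 'b) \<Rightarrow> 'a \<Rightarrow> 'b ^ 'd"
  where "operator_tuple T = (\<lambda>x. \<chi> i. T i x)"

end

theory Submission
  imports Defs
begin

text \<open>
  Write \<open>n i\<close> for the norm of \<open>T i\<close> and \<open>N\<close> for the $\ell_p$ norm of \<open>n\<close>. At a unit vector \<open>x\<close> where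
  all the \<open>T i\<close> attain their norms, the tuple \<open>T x\<close> has norm \<open>N\<close>, so the operator tuple has norm
  \<open>N\<close>, the largest value that the norms \<open>n i\<close> permit. Let
  \<open>c i = (n i / N) powr (p - 1)\<close>; as all \<open>n i\<close> are positive, this is the gradient at \<open>n\<close> of the
  $\ell_p$ norm on $\mathbb{R}^d$, also for \<open>p = 1\<close>.

  Uniqueness of the support functional is a computation in $\ell_p^d$. A norm-one functional \<open>F\<close>
  on the operators into the sum is determined by its restrictions to operators concentrated in a
  single summand. Adding \<open>t\<close> times such an operator \<open>S\<close> to the tuple changes the norm by at most
  \<open>t * c i * \<parallel>S\<parallel> + o(t)\<close>, so if \<open>F\<close> attains its norm at the tuple then its \<open>i\<close>-th restriction
  has norm at most \<open>c i\<close> (\<open>contraction_on_summand\<close>). The values of the restrictions at the \<open>T i\<close>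
  add up to \<open>N\<close>, which is also the sum of the bounds \<open>c i * n i\<close>; hence every bound is attained
  and the \<open>i\<close>-th restriction is \<open>c i\<close> times a support functional of \<open>T i\<close>
  (\<open>support_functional_restricts\<close>). By smoothness of \<open>T i\<close> there is only one of those.

  Existence uses the common norming vector again: with Hahn-Banach functionals \<open>g i\<close> norming
  \<open>T i x\<close>, the functional taking \<open>S\<close> to the sum of the \<open>c i * g i (S x $ i)\<close> has norm at most one
  by Hoelder's inequality (\<open>sum_lp_dual_le\<close>) and takes the value \<open>N\<close> at the tuple.
\<close>

section \<open>The $\ell_p$ norm on $\mathbb{R}^d$ and its gradient\<close>

definition lp_norm :: "real \<Rightarrow> ('d::finite \<Rightarrow> real) \<Rightarrow> real"
  where "lp_norm p a = (\<Sum>i\<in>UNIV. a i powr p) powr (1 / p)"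

text \<open>
  For \<open>n\<close> with positive entries this is the gradient of the $\ell_p$ norm at \<open>n\<close>. It has $\ell_q$
  norm at most one for the conjugate exponent \<open>q\<close>, and that is how it is used: \<open>sum_lp_dual_le\<close> and
  \<open>sum_lp_dual_self\<close> say that it is a norm-one functional norming \<open>n\<close>.
\<close>

definition lp_dual :: "real \<Rightarrow> ('d::finite \<Rightarrow> real) \<Rightarrow> 'd \<Rightarrow> real"
  where "lp_dual p n i = (n i / lp_norm p n) powr (p - 1)"

lemma lp_norm_nonneg: "0 \<le> lp_norm p a"
  by (simp add: lp_norm_def)

lemma lp_norm_powr: "p \<ge> 1 \<Longrightarrow> lp_norm p a powr p = (\<Sum>i\<in>UNIV. a i powr p)"
  by (simp add: lp_norm_def powr_powr sum_nonneg)

lemma lp_norm_mono: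
  assumes "p \<ge> 1" "\<And>i. 0 \<le> a i" "\<And>i. a i \<le> b i"
  shows "lp_norm p a \<le> lp_norm p b"
  unfolding lp_norm_def using assms
  by (intro powr_mono2 sum_mono sum_nonneg) auto

lemma lp_norm_scale:
  assumes "p \<ge> 1" "0 \<le> c" "\<And>i. 0 \<le> a i"
  shows "lp_norm p (\<lambda>i. c * a i) = c * lp_norm p a"
proof -
  have "(\<Sum>i\<in>UNIV. (c * a i) powr p) = c powr p * (\<Sum>i\<in>UNIV. a i powr p)"
    using assms by (simp add: powr_mult sum_distrib_left)
  then show ?thesis
    using assms by (simp add: lp_norm_def powr_mult powr_powr sum_nonneg)
qed

lemma component_le_lp_norm:
  assumes "p \<ge> 1" "\<And>i. 0 \<le> a i"
  shows "a j \<le> lp_norm p a"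
proof -
  have "a j powr p \<le> (\<Sum>i\<in>UNIV. a i powr p)"
    by (rule member_le_sum) auto
  then have "(a j powr p) powr (1/p) \<le> lp_norm p a"
    unfolding lp_norm_def using assms by (intro powr_mono2) auto
  then show ?thesis using assms by (simp add: powr_powr)
qed

lemma lp_norm_pos:
  assumes "p \<ge> 1" "\<And>i. 0 \<le> a i" "0 < a j"
  shows "0 < lp_norm p a"
  using component_le_lp_norm[of p a j] assms by fastforce

lemma sum_normalized_powr:
  assumes "p \<ge> 1" "\<And>i. 0 \<le> n i" "0 < lp_norm p n"
  shows "(\<Sum>i\<in>UNIV. (n i / lp_norm p n) powr p) = 1"
proof -
  have "(\<Sum>i\<in>UNIV. (n i / lp_norm p n) powr p) = (\<Sum>i\<in>UNIV. n i powr p) / lp_norm p n powr p"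
    using assms by (simp add: powr_divide sum_divide_distrib)
  also have "\<dots> = lp_norm p n powr p / lp_norm p n powr p"
    using lp_norm_powr[of p n] assms by simp
  finally show ?thesis using assms by simp
qed

lemma sum_lp_dual_self:
  assumes "p \<ge> 1" "\<And>i. 0 \<le> n i" "0 < lp_norm p n"
  shows "(\<Sum>i\<in>UNIV. lp_dual p n i * n i) = lp_norm p n"
proof -
  have "lp_dual p n i * n i = lp_norm p n * (n i / lp_norm p n) powr p" for i
  proof -
    have "(n i / lp_norm p n) powr p = (n i / lp_norm p n) powr (p - 1) * (n i / lp_norm p n)"
      using powr_add[of "n i / lp_norm p n" "p - 1" 1] assms by (cases "n i = 0") auto
    then show ?thesis using assms by (simp add: lp_dual_def)
  qed
  then show ?thesis
    using sum_normalized_powr[OF assms] by (simp flip: sum_distrib_left)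
qed

text \<open>
  Hoelder's inequality against the normalized \<open>n\<close>. After scaling both vectors to norm one, Young's
  inequality \<open>u powr (p - 1) * v \<le> (1 - 1/p) * u powr p + (1/p) * v powr p\<close> in each entry sums up
  to one.
\<close>

lemma sum_lp_dual_le:
  assumes p: "p \<ge> 1" and n: "\<And>i. 0 \<le> n i" "0 < lp_norm p n" and a: "\<And>i. 0 \<le> a i"
  shows "(\<Sum>i\<in>UNIV. lp_dual p n i * a i) \<le> lp_norm p a"
proof (cases "\<exists>j. a j > 0")
  case False
  then have "a = (\<lambda>i. 0)" using a by (force simp: le_less)
  then show ?thesis by (simp add: lp_norm_nonneg)
next
  case True
  then have A: "0 < lp_norm p a" using lp_norm_pos p a by blast
  define u v where "u i = n i / lp_norm p n" and "v i = a i / lp_norm p a" for i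
  have uv: "u i \<ge> 0" "v i \<ge> 0" for i
    using n a A by (auto simp: u_def v_def)
  have young: "u i powr (p - 1) * v i \<le> (1 - 1/p) * u i powr p + (1/p) * v i powr p" for i
  proof (cases "u i > 0 \<and> v i > 0")
    case True
    then show ?thesis
      using Youngs_inequality_0[of "1 - 1/p" "1/p" "u i powr p" "v i powr p"] p
      by (simp add: powr_powr algebra_simps)
  next
    case False
    then have "u i = 0 \<or> v i = 0" using uv[of i] by linarith
    then show ?thesis using p by auto
  qed
  have "(\<Sum>i\<in>UNIV. u i powr (p - 1) * v i)
      \<le> (\<Sum>i\<in>UNIV. (1 - 1/p) * u i powr p + (1/p) * v i powr p)"
    by (rule sum_mono) (rule young)
  also have "\<dots> = (1 - 1/p) * (\<Sum>i\<in>UNIV. u i powr p) + (1/p) * (\<Sum>i\<in>UNIV. v i powr p)"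
    by (simp add: sum.distrib sum_distrib_left)
  also have "\<dots> = 1"
    using sum_normalized_powr[OF p n] sum_normalized_powr[OF p a A] by (simp add: u_def v_def)
  finally have "(\<Sum>i\<in>UNIV. u i powr (p - 1) * v i) \<le> 1" .
  moreover have "(\<Sum>i\<in>UNIV. lp_dual p n i * a i) = (\<Sum>i\<in>UNIV. u i powr (p - 1) * v i) * lp_norm p a"
    using A by (simp add: lp_dual_def u_def v_def sum_distrib_right)
  ultimately show ?thesis using A by simp
qed

text \<open>
  The gradient at \<open>a + b\<close> norms \<open>a + b\<close> and is bounded by the norm on \<open>a\<close> and on \<open>b\<close>
  separately.
\<close>

lemma lp_norm_triangle:
  assumes p: "p \<ge> 1" and a: "\<And>i. 0 \<le> a i" and b: "\<And>i. 0 \<le> b i"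
  shows "lp_norm p (\<lambda>i. a i + b i) \<le> lp_norm p a + lp_norm p b"
proof (cases "0 < lp_norm p (\<lambda>i. a i + b i)")
  case False
  then show ?thesis using lp_norm_nonneg[of p a] lp_norm_nonneg[of p b] by linarith
next
  case True
  let ?c = "lp_dual p (\<lambda>i. a i + b i)"
  have "lp_norm p (\<lambda>i. a i + b i) = (\<Sum>i\<in>UNIV. ?c i * (a i + b i))"
    using sum_lp_dual_self[OF p _ True] a b by simp
  also have "\<dots> = (\<Sum>i\<in>UNIV. ?c i * a i) + (\<Sum>i\<in>UNIV. ?c i * b i)"
    by (simp add: distrib_left sum.distrib)
  also have "\<dots> \<le> lp_norm p a + lp_norm p b"
    using sum_lp_dual_le[OF p _ True a] sum_lp_dual_le[OF p _ True b] a b by (simp add: add_mono)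
  finally show ?thesis .
qed

text \<open>
  Along the \<open>i\<close>-th axis with speed \<open>b\<close> the norm has derivative \<open>lp_dual p n i * b\<close> at \<open>n\<close>, and an
  affine function that agrees with the norm at \<open>t = 0\<close> and is below it afterwards cannot have a
  larger slope. Positivity of \<open>n i\<close> is what makes the norm differentiable there when \<open>p = 1\<close>.
\<close>

lemma slope_le_lp_dual:
  assumes p: "p \<ge> 1" and n: "\<And>i. 0 < n i"
    and slope: "\<And>t. t > 0 \<Longrightarrow> lp_norm p n + t * s \<le> lp_norm p (n(i := n i + t * b))"
  shows "s \<le> lp_dual p n i * b"
proof -
  define R where "R = (\<Sum>j\<in>UNIV - {i}. n j powr p)"
  define \<phi> where "\<phi> t = (R + (n i + t * b) powr p) powr (1/p)" for t
  have N: "0 < lp_norm p n" using lp_norm_pos[OF p less_imp_le[OF n] n] .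
  have split: "(\<Sum>j\<in>UNIV. (n(i := n i + t * b)) j powr p) = R + (n i + t * b) powr p" for t
    unfolding R_def by (subst sum.remove[of UNIV i]) auto
  have phi: "lp_norm p (n(i := n i + t * b)) = \<phi> t" for t
    unfolding lp_norm_def \<phi>_def split ..
  have phi0: "\<phi> 0 = lp_norm p n" using phi[of 0] by simp
  have Np: "R + n i powr p = lp_norm p n powr p"
    using split[of 0] lp_norm_powr[OF p, of n] by simp
  have D: "(\<phi> has_real_derivative lp_dual p n i * b) (at 0)"
  proof -
    let ?d = "(1/p) * (R + (n i + 0 * b) powr p) powr (1/p - of_nat 1)
        * (p * (n i + 0 * b) powr (p - of_nat 1) * b)"
    have pos: "0 < R + n i powr p" using Np N by simp
    have "((\<lambda>t. (R + (n i + t * b) powr p) powr (1/p)) has_real_derivative ?d) (at 0)"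
      using pos n[of i] by (intro DERIV_fun_powr derivative_eq_intros) (auto simp del: of_nat_1)
    moreover have "?d = lp_dual p n i * b"
    proof -
      have "(lp_norm p n powr p) powr (1/p - 1) = lp_norm p n powr (1 - p)"
        using p by (simp add: powr_powr algebra_simps)
      also have "\<dots> = 1 / lp_norm p n powr (p - 1)"
        using powr_minus_divide[of "lp_norm p n" "p - 1"] by simp
      finally show ?thesis
        using p N less_imp_le[OF n] by (simp add: Np lp_dual_def powr_divide)
    qed
    ultimately show ?thesis unfolding \<phi>_def by simp
  qed
  have lim: "((\<lambda>t. (\<phi> t - \<phi> 0) / t) \<longlongrightarrow> lp_dual p n i * b) (at_right 0)"
    using D unfolding has_field_derivative_iff
    by (auto intro: filterlim_at_split[THEN iffD1, THEN conjunct2])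
  show ?thesis
  proof (rule tendsto_lowerbound[OF lim])
    show "\<forall>\<^sub>F t in at_right 0. s \<le> (\<phi> t - \<phi> 0) / t"
      using slope by (intro eventually_at_rightI[of 0 1]) (auto simp: phi[symmetric] phi0 field_simps)
  qed simp
qed

section \<open>Norming functionals on real normed spaces\<close>

text \<open>
  The Hahn-Banach theorem enters only as the existence of norming functionals. These are found as
  the minimal sublinear functionals below the norm, which avoids extending functionals from
  subspaces. Being dominated by the norm is made part of the notion: it bounds chains from below.
\<close>

definition sublinear :: "('a::real_normed_vector \<Rightarrow> real) \<Rightarrow> bool"
  where "sublinear q \<longleftrightarrow> (\<forall>x. q x \<le> norm x) \<and> (\<forall>x y. q (x + y) \<le> q x + q y) \<and>
    (\<forall>c x. 0 \<le> c \<longrightarrow> q (c *\<^sub>R x) = c * q x)"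

lemma sublinear_ge:
  assumes "sublinear q"
  shows "- norm (x::'a::real_normed_vector) \<le> q x"
proof -
  have "q (0 *\<^sub>R 0) = 0 * q 0" using assms unfolding sublinear_def by blast
  then have "q 0 = 0" by simp
  moreover have "q (x + - x) \<le> q x + q (- x)" "q (- x) \<le> norm (- x)"
    using assms unfolding sublinear_def by blast+
  ultimately show ?thesis by simp
qed

text \<open>
  A sublinear functional below \<open>q\<close> whose value at \<open>- z\<close> is at most \<open>- q z\<close>. So a minimal \<open>q\<close> must
  be additive, and starting from the norm one can prescribe the value at one vector.
\<close>

definition lower_along :: "('a::real_normed_vector \<Rightarrow> real) \<Rightarrow> 'a \<Rightarrow> 'a \<Rightarrow> real"
  where "lower_along q z x = (INF t\<in>{0..}. q (x + t *\<^sub>R z) - t * q z)"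

lemma
  assumes q: "sublinear q"
  shows sublinear_lower_along: "sublinear (lower_along q z)"
    and lower_along_le: "0 \<le> t \<Longrightarrow> lower_along q z x \<le> q (x + t *\<^sub>R z) - t * q z"
proof -
  have q1: "q x \<le> norm x" and q2: "q (x + y) \<le> q x + q y"
    and q3: "0 \<le> c \<Longrightarrow> q (c *\<^sub>R x) = c * q x" for x y c
    using q unfolding sublinear_def by blast+
  have low: "- norm x \<le> q (x + t *\<^sub>R z) - t * q z" if "0 \<le> t" for x t
  proof -
    have "t * q z = q ((x + t *\<^sub>R z) + - x)" using q3[OF that] by simp
    also have "\<dots> \<le> q (x + t *\<^sub>R z) + q (- x)" by (rule q2)
    finally show ?thesis using q1[of "- x"] by simp
  qed
  have bdd: "bdd_below ((\<lambda>t. q (x + t *\<^sub>R z) - t * q z) ` {0..})" for x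
    by (rule bdd_belowI2[of _ "- norm x"]) (auto intro: low)
  show le: "lower_along q z x \<le> q (x + t *\<^sub>R z) - t * q z" if "0 \<le> t" for t x
    unfolding lower_along_def using that by (intro cINF_lower bdd) auto
  have greatest: "m \<le> lower_along q z x" if "\<And>t. 0 \<le> t \<Longrightarrow> m \<le> q (x + t *\<^sub>R z) - t * q z" for m x
    unfolding lower_along_def using that by (intro cINF_greatest) auto
  have hom_le: "c * lower_along q z x \<le> lower_along q z (c *\<^sub>R x)" if "0 < c" for c x
  proof (rule greatest)
    fix t :: real assume t: "0 \<le> t"
    have "c * lower_along q z x \<le> c * (q (x + (t/c) *\<^sub>R z) - (t/c) * q z)"
      using le[of "t/c" x] t that by (intro mult_left_mono) auto
    also have "\<dots> = q (c *\<^sub>R (x + (t/c) *\<^sub>R z)) - t * q z"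
      using that by (simp add: q3 right_diff_distrib)
    finally show "c * lower_along q z x \<le> q (c *\<^sub>R x + t *\<^sub>R z) - t * q z"
      using that by (simp add: scaleR_add_right)
  qed
  show "sublinear (lower_along q z)"
    unfolding sublinear_def
  proof (intro conjI allI impI)
    fix x show "lower_along q z x \<le> norm x"
      using le[of 0 x] q1[of x] by simp
  next
    fix x y
    have *: "lower_along q z (x + y) - (q (y + t *\<^sub>R z) - t * q z) \<le> q (x + s *\<^sub>R z) - s * q z"
      if "0 \<le> t" "0 \<le> s" for s t
    proof -
      have "lower_along q z (x + y) \<le> q ((x + s *\<^sub>R z) + (y + t *\<^sub>R z)) - (s + t) * q z"
        using le[of "s + t" "x + y"] that by (simp add: algebra_simps)
      then show ?thesis using q2[of "x + s *\<^sub>R z" "y + t *\<^sub>R z"] by (simp add: algebra_simps)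
    qed
    have "lower_along q z (x + y) - lower_along q z x \<le> q (y + t *\<^sub>R z) - t * q z" if "0 \<le> t" for t
    proof -
      have "lower_along q z (x + y) - (q (y + t *\<^sub>R z) - t * q z) \<le> lower_along q z x"
        by (rule greatest) (rule *[OF that])
      then show ?thesis by simp
    qed
    then have "lower_along q z (x + y) - lower_along q z x \<le> lower_along q z y"
      by (rule greatest)
    then show "lower_along q z (x + y) \<le> lower_along q z x + lower_along q z y"
      by simp
  next
    fix c :: real and x assume "0 \<le> c"
    have "lower_along q z 0 = 0"
    proof (rule antisym)
      show "lower_along q z 0 \<le> 0" using le[of 0 0] q3[of 0 0] by simp
      show "0 \<le> lower_along q z 0" by (rule greatest) (simp add: q3)
    qed
    moreover have "lower_along q z (c *\<^sub>R x) \<le> c * lower_along q z x" if "0 < c"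
      using hom_le[of "1/c" "c *\<^sub>R x"] that by (simp add: field_simps)
    ultimately show "lower_along q z (c *\<^sub>R x) = c * lower_along q z x"
      using hom_le[of c x] \<open>0 \<le> c\<close> by (cases "c = 0") (auto intro: antisym)
  qed
qed

text \<open>
  Zorn's lemma: the pointwise infimum of a chain is sublinear. Subadditivity needs the chain
  condition, since the infima at \<open>x\<close> and at \<open>y\<close> must be approached by one member of the chain.
\<close>

lemma sublinear_minimal_exists:
  assumes q: "sublinear (q :: 'a::real_normed_vector \<Rightarrow> real)"
  obtains m where "sublinear m" "m \<le> q" "\<And>r. sublinear r \<Longrightarrow> r \<le> m \<Longrightarrow> r = m"
proof -
  define A where "A = {r. sublinear r \<and> r \<le> q}"
  have "\<exists>m\<in>A. \<forall>r\<in>A. m \<ge> r \<longrightarrow> r = m"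
  proof (rule predicate_Zorn)
    show "partial_order_on A (relation_of (\<ge>) A)"
      by (rule partial_order_on_relation_ofI) auto
  next
    fix C assume C: "C \<in> Chains (relation_of (\<ge>) A)"
    then have CA: "r \<in> A" if "r \<in> C" for r
      using that unfolding Chains_def relation_of_def by blast
    have tot: "r \<le> r' \<or> r' \<le> r" if "r \<in> C" "r' \<in> C" for r r'
      using C that unfolding Chains_def relation_of_def by blast
    show "\<exists>u\<in>A. \<forall>r\<in>C. r \<ge> u"
    proof (cases "C = {}")
      case True
      then show ?thesis using q unfolding A_def by auto
    next
      case False
      define u where "u x = (INF r\<in>C. r x)" for x
      have bdd: "bdd_below ((\<lambda>r. r x) ` C)" for x
        using CA sublinear_ge unfolding A_def by (intro bdd_belowI2[of _ "- norm x"]) blast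
      have le: "u x \<le> r x" if "r \<in> C" for r x
        unfolding u_def using that bdd by (intro cINF_lower)
      have greatest: "l \<le> u x" if "\<And>r. r \<in> C \<Longrightarrow> l \<le> r x" for l x
        unfolding u_def using that False by (intro cINF_greatest)
      obtain r0 where r0: "r0 \<in> C" using False by blast
      have "sublinear u"
        unfolding sublinear_def
      proof (intro conjI allI impI)
        fix x
        have "u x \<le> r0 x" by (rule le[OF r0])
        also have "\<dots> \<le> norm x" using CA[OF r0] unfolding A_def sublinear_def by blast
        finally show "u x \<le> norm x" .
      next
        fix x y
        \<comment> \<open>The smaller of two members of the chain bounds both summands at once.\<close>
        have *: "u (x + y) \<le> r x + r' y" if r: "r \<in> C" and r': "r' \<in> C" for r r'
        proof -
          obtain s where s: "s \<in> C" "s \<le> r" "s \<le> r'"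
            using tot[OF r r'] r r' order_refl by metis
          have "u (x + y) \<le> s (x + y)" by (rule le[OF s(1)])
          also have "\<dots> \<le> s x + s y" using CA[OF s(1)] unfolding A_def sublinear_def by blast
          also have "\<dots> \<le> r x + r' y" using s by (intro add_mono) (auto dest: le_funD)
          finally show ?thesis .
        qed
        have "u (x + y) - u x \<le> r' y" if "r' \<in> C" for r'
        proof -
          have "u (x + y) - r' y \<le> u x"
            using *[OF _ that] by (intro greatest) (simp add: algebra_simps)
          then show ?thesis by simp
        qed
        then have "u (x + y) - u x \<le> u y" by (rule greatest)
        then show "u (x + y) \<le> u x + u y" by simp
      next
        fix c :: real and x assume c: "0 \<le> c"
        have hom: "r (c *\<^sub>R x) = c * r x" if "r \<in> C" for r
          using CA[OF that] c unfolding A_def sublinear_def by blast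
        show "u (c *\<^sub>R x) = c * u x"
        proof (cases "c = 0")
          case True
          have "(\<lambda>r. r (0::'a)) ` C = {0}" using hom True False by force
          then show ?thesis using True by (simp add: u_def)
        next
          case False
          then have cpos: "0 < c" using c by simp
          have "u (c *\<^sub>R x) / c \<le> u x"
          proof (rule greatest)
            fix r assume r: "r \<in> C"
            show "u (c *\<^sub>R x) / c \<le> r x"
              using le[OF r, of "c *\<^sub>R x"] cpos
              by (simp add: hom[OF r] pos_divide_le_eq mult.commute)
          qed
          moreover have "c * u x \<le> u (c *\<^sub>R x)"
          proof (rule greatest)
            fix r assume r: "r \<in> C"
            show "c * u x \<le> r (c *\<^sub>R x)"
              using le[OF r, of x] cpos by (simp add: hom[OF r])
          qed
          ultimately show ?thesis using cpos by (simp add: field_simps)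
        qed
      qed
      moreover have "u \<le> q"
        using le[OF r0] CA[OF r0] unfolding A_def le_fun_def by (blast intro: order_trans)
      ultimately show ?thesis using le unfolding A_def le_fun_def by blast
    qed
  qed
  then obtain m where m: "m \<in> A" and min: "\<forall>r\<in>A. m \<ge> r \<longrightarrow> r = m" by blast
  show ?thesis
  proof (rule that)
    show "sublinear m" "m \<le> q" using m unfolding A_def by auto
    show "r = m" if "sublinear r" "r \<le> m" for r
      using min that order_trans[OF that(2) \<open>m \<le> q\<close>] unfolding A_def by blast
  qed
qed

text \<open>
  A minimal sublinear \<open>m\<close> below \<open>lower_along norm z\<close> equals \<open>lower_along m y\<close> for every \<open>y\<close>, which
  says \<open>m x + m y \<le> m (x + y)\<close>; so \<open>m\<close> is linear. Its value at \<open>- z\<close> is at most \<open>- norm z\<close>.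
\<close>

theorem real_norming_functional:
  fixes z :: "'a::real_normed_vector"
  obtains g where "linear g" "\<And>x. \<bar>g x\<bar> \<le> norm x" "g z = norm z"
proof -
  have norm_sub: "sublinear (norm :: 'a \<Rightarrow> real)"
    by (auto simp: sublinear_def norm_triangle_ineq)
  obtain m where m: "sublinear m" "m \<le> lower_along norm z"
    and min: "\<And>r. sublinear r \<Longrightarrow> r \<le> m \<Longrightarrow> r = m"
    using sublinear_minimal_exists[OF sublinear_lower_along[OF norm_sub, of z]] by blast
  have m1: "m x \<le> norm x" and m2: "m (x + y) \<le> m x + m y"
    and m3: "0 \<le> c \<Longrightarrow> m (c *\<^sub>R x) = c * m x" for x y c
    using m(1) unfolding sublinear_def by blast+
  have "lower_along m y = m" for y
  proof (rule min)
    show "sublinear (lower_along m y)" by (rule sublinear_lower_along[OF m(1)])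
    show "lower_along m y \<le> m"
      using lower_along_le[OF m(1), of 0] by (simp add: le_fun_def)
  qed
  then have "m x \<le> m (x + y) - m y" for x y
    using lower_along_le[OF m(1), of 1 y x] by simp
  then have add: "m (x + y) = m x + m y" for x y
    using m2[of x y] by (metis add_le_cancel_right antisym diff_add_cancel)
  have zero: "m 0 = 0" using m3[of 0 0] by simp
  have neg: "m (- x) = - m x" for x using add[of x "- x"] zero by simp
  have "linear m"
  proof (rule linearI)
    fix c :: real and x
    show "m (c *\<^sub>R x) = c *\<^sub>R m x"
      using m3[of c x] m3[of "- c" x] neg[of "c *\<^sub>R x"] by (cases "0 \<le> c") auto
  qed (rule add)
  moreover have "\<bar>m x\<bar> \<le> norm x" for x
    using m1[of x] m1[of "- x"] neg by simp
  moreover have "m z = norm z"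
  proof (rule antisym)
    have "m (- z) \<le> lower_along norm z (- z)" using m(2) by (rule le_funD)
    also have "\<dots> \<le> - norm z" using lower_along_le[OF norm_sub, of 1 z "- z"] by simp
    finally show "norm z \<le> m z" using neg by simp
  qed (rule m1)
  ultimately show ?thesis using that by blast
qed

section \<open>Norming functionals over the scalar field\<close>

lemma to_complex_one: "to_complex (1::'k::real_or_complex) = 1"
proof -
  have "to_complex (1::'k) * to_complex (1::'k) = to_complex (1::'k)"
    using to_complex_mult[of "1::'k" 1] by simp
  moreover have "to_complex (1::'k) \<noteq> 0"
    using norm_to_complex[of "1::'k"] by auto
  ultimately show ?thesis by simp
qed

lemma to_complex_of_real: "to_complex (of_real r :: 'k::real_or_complex) = complex_of_real r"
  unfolding of_real_def by (simp add: to_complex_scaleR to_complex_one)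

lemma to_complex_diff: "to_complex (a - b :: 'k::real_or_complex) = to_complex a - to_complex b"
  using to_complex_add[of a "- 1 *\<^sub>R b"] to_complex_scaleR[of "- 1" b] by simp

lemma inj_to_complex: "inj (to_complex :: 'k::real_or_complex \<Rightarrow> complex)"
proof (rule injI)
  fix a b :: 'k assume "to_complex a = to_complex b"
  then have "norm (to_complex (a - b)) = 0" by (simp add: to_complex_diff)
  then show "a = b" by (simp add: norm_to_complex)
qed

lemma to_complex_sum: "to_complex (\<Sum>i\<in>A. f i :: 'k::real_or_complex) = (\<Sum>i\<in>A. to_complex (f i))"
proof (induction A rule: infinite_finite_induct)
  case empty
  show ?case using to_complex_of_real[of 0] by simp
qed (use to_complex_of_real[of 0] in \<open>simp_all add: to_complex_add\<close>)

text \<open>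
  Equality in the triangle inequality: the real parts are at most \<open>r i\<close> and have the same sum, so
  they equal \<open>r i\<close>, and then the norm bound leaves no room for an imaginary part.
\<close>

lemma sum_eq_sum_bounds_imp_eq:
  fixes z :: "'i \<Rightarrow> 'k::real_or_complex"
  assumes I: "finite I" and bound: "\<And>i. i \<in> I \<Longrightarrow> norm (z i) \<le> r i"
    and sum: "(\<Sum>i\<in>I. z i) = of_real (\<Sum>i\<in>I. r i)" and i: "i \<in> I"
  shows "z i = of_real (r i)"
proof -
  have le: "Re (to_complex (z j)) \<le> r j" if "j \<in> I" for j
    using complex_Re_le_cmod[of "to_complex (z j)"] bound[OF that] by (simp add: norm_to_complex)
  have "(\<Sum>j\<in>I. to_complex (z j)) = complex_of_real (\<Sum>j\<in>I. r j)"
    using sum by (metis to_complex_sum to_complex_of_real)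
  then have "(\<Sum>j\<in>I. Re (to_complex (z j))) = (\<Sum>j\<in>I. r j)"
    by (metis Re_sum Re_complex_of_real)
  then have "(\<Sum>j\<in>I. r j - Re (to_complex (z j))) = 0"
    by (simp add: sum_subtractf)
  then have re: "Re (to_complex (z i)) = r i"
    using sum_nonneg_eq_0_iff[OF I, of "\<lambda>j. r j - Re (to_complex (z j))"] le i by auto
  have "cmod (to_complex (z i)) \<le> r i" using bound[OF i] by (simp add: norm_to_complex)
  then have "(Re (to_complex (z i)))\<^sup>2 + (Im (to_complex (z i)))\<^sup>2 \<le> (r i)\<^sup>2"
    by (metis cmod_power2 norm_ge_zero power_mono)
  then have "to_complex (z i) = to_complex (of_real (r i) :: 'k)"
    using re by (auto simp: complex_eq_iff to_complex_of_real)
  then show ?thesis using inj_to_complex by (auto dest: injD)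
qed

lemma unit_multiple_is_norm:
  fixes z :: "'k::real_normed_field"
  obtains u where "norm u = 1" "u * z = of_real (norm z)"
proof (cases "z = 0")
  case True
  then show ?thesis using that[of 1] by simp
next
  case False
  then show ?thesis using that[of "of_real (norm z) / z"] by (simp add: norm_divide)
qed

text \<open>
  The second case isolates the real and imaginary parts of a scalar without leaving the field:
  \<open>J\<close> is the preimage of the imaginary unit.
\<close>

lemma scalar_cases:
  obtains (real) "\<And>c::'k::real_or_complex. \<exists>a. c = of_real a"
  | (complex) J where "J * J = (- 1::'k)" "\<And>c::'k. \<exists>a b. c = of_real a + of_real b * J"
    "\<And>a b. (norm (of_real a + of_real b * J))\<^sup>2 = a\<^sup>2 + b\<^sup>2"
proof (cases "range (to_complex :: 'k \<Rightarrow> complex) = UNIV")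
  case True
  then obtain J :: 'k where J: "to_complex J = \<i>" by (metis surjD)
  show ?thesis
  proof (rule complex)
    have "to_complex (J * J) = to_complex (of_real (- 1) :: 'k)"
      unfolding to_complex_mult to_complex_of_real J by simp
    then show "J * J = - 1" using injD[OF inj_to_complex] by fastforce
    have tc: "to_complex (of_real a + of_real b * J) = Complex a b" for a b
      by (simp add: to_complex_add to_complex_mult to_complex_of_real J complex_eq_iff)
    show "\<exists>a b. c = of_real a + of_real b * J" for c
    proof (intro exI)
      show "c = of_real (Re (to_complex c)) + of_real (Im (to_complex c)) * J"
        by (rule injD[OF inj_to_complex]) (simp add: tc)
    qed
    show "(norm (of_real a + of_real b * J))\<^sup>2 = a\<^sup>2 + b\<^sup>2" for a b
      unfolding norm_to_complex[symmetric, of "of_real a + of_real b * J"] tc by (simp add: cmod_power2)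
  qed
next
  case False
  then have R: "range (to_complex :: 'k \<Rightarrow> complex) = \<real>" using range_to_complex by blast
  show ?thesis
  proof (rule real)
    fix c :: 'k
    have "to_complex c \<in> \<real>" using R by blast
    then obtain a where "to_complex c = complex_of_real a" by (elim Reals_cases)
    then have "to_complex c = to_complex (of_real a :: 'k)" by (simp add: to_complex_of_real)
    then show "\<exists>a. c = of_real a" using injD[OF inj_to_complex] by blast
  qed
qed

text \<open>
  Over a copy of the complex numbers, a real norming functional \<open>h\<close> is the real part of
  \<open>g x = h x - J * h (J x)\<close>. Rotating \<open>x\<close> so that \<open>g x\<close> becomes real and nonnegative shows that
  passing from \<open>h\<close> to \<open>g\<close> does not increase the norm.
\<close>

theorem (in normed_space_over) norming_functional:
  obtains g :: "'a \<Rightarrow> 'k" where "\<And>x y. g (x + y) = g x + g y" "\<And>c x. g (scale c x) = c * g x"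
    "\<And>x. norm (g x) \<le> norm x" "g z = of_real (norm z)"
proof -
  obtain h where h: "linear h" and hle: "\<And>x. \<bar>h x\<bar> \<le> norm x" and hz: "h z = norm z"
    using real_norming_functional[of z] by blast
  have hs: "h (scale (of_real a) x) = a * h x" for a x
    using linear_cmul[OF h] by (simp add: scale_of_real)
  show ?thesis
  proof (cases rule: scalar_cases[where 'k='k])
    case real
    show ?thesis
    proof (rule that[of "\<lambda>x. of_real (h x)"])
      show "of_real (h (scale c x)) = c * of_real (h x)" for c x
        using real[of c] hs by (metis of_real_mult)
    qed (use hle hz linear_add[OF h] in simp_all)
  next
    case (complex J)
    define g where "g x = of_real (h x) - J * of_real (h (scale J x))" for x
    have gJ: "g x = of_real (h x) + of_real (- h (scale J x)) * J" for x
      by (simp add: g_def)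
    have add: "g (x + y) = g x + g y" for x y
      by (simp add: g_def scale_right_distrib linear_add[OF h] algebra_simps)
    have re: "g (scale (of_real a) x) = of_real a * g x" for a x
    proof -
      have "scale J (scale (of_real a) x) = scale (of_real a) (scale J x)"
        by (simp add: mult.commute)
      then have "h (scale J (scale (of_real a) x)) = a * h (scale J x)" using hs by metis
      then show ?thesis by (simp only: g_def hs of_real_mult) (simp add: algebra_simps)
    qed
    have im: "g (scale J x) = J * g x" for x
    proof -
      have "h (scale J (scale J x)) = h (scale (of_real (- 1)) x)" using complex(1) by simp
      then have "g (scale J x) = of_real (h (scale J x)) + J * of_real (h x)"
        using hs[of "- 1" x] by (simp add: g_def)
      also have "\<dots> = J * of_real (h x) - (J * J) * of_real (h (scale J x))"
        unfolding complex(1) by simp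
      also have "\<dots> = J * g x" by (simp add: g_def algebra_simps)
      finally show ?thesis .
    qed
    have hom: "g (scale c x) = c * g x" for c x
    proof -
      obtain a b where c: "c = of_real a + of_real b * J" using complex(2) by blast
      have "scale c x = scale (of_real a) x + scale (of_real b) (scale J x)"
        unfolding c by (simp add: scale_left_distrib)
      then show ?thesis unfolding c by (simp only: add re im) (simp add: algebra_simps)
    qed
    have le: "norm (g x) \<le> norm x" for x
    proof -
      obtain u where u: "norm u = 1" "u * g x = of_real (norm (g x))"
        by (rule unit_multiple_is_norm)
      \<comment> \<open>A vector of the same norm at which \<open>g\<close> is real, so that \<open>g y = h y\<close>.\<close>
      define y where "y = scale u x"
      have gy: "g y = of_real (norm (g x))" using u hom by (simp add: y_def)
      have "0 = g y - of_real (norm (g x))" using gy by simp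
      also have "\<dots> = of_real (h y - norm (g x)) + of_real (- h (scale J y)) * J"
        using gJ[of y] by simp
      finally have "(h y - norm (g x))\<^sup>2 + (- h (scale J y))\<^sup>2 = 0"
        using complex(3)[of "h y - norm (g x)" "- h (scale J y)"] by simp
      then have "norm (g x) = h y" by (simp add: sum_power2_eq_zero_iff)
      also have "\<dots> \<le> norm y" using hle[of y] by simp
      also have "\<dots> = norm x" using u(1) by (simp add: y_def norm_scale)
      finally show ?thesis .
    qed
    \<comment> \<open>The real part of \<open>g z\<close> already has the largest possible modulus.\<close>
    have "g z = of_real (norm z)"
    proof -
      have "(h z)\<^sup>2 + (- h (scale J z))\<^sup>2 = (norm (g z))\<^sup>2"
        using complex(3)[of "h z" "- h (scale J z)"] gJ[of z] by simp
      also have "\<dots> \<le> (norm z)\<^sup>2" using le[of z] by (intro power_mono) auto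
      finally have "h (scale J z) = 0" by (simp add: hz)
      then show ?thesis by (simp add: g_def hz)
    qed
    then show ?thesis using that add hom le by blast
  qed
qed

section \<open>Support functionals in spaces given by a carrier\<close>

text \<open>
  The instance of interest is the space of compact operators, whose carrier is a proper subset of a
  function type; this isolates what the theory of dual norms requires of such a space.
\<close>

locale normed_nspace =
  fixes V :: "('k::real_or_complex, 'a::ab_group_add) nspace"
  assumes zero_mem: "0 \<in> carrier V"
    and add_mem: "v \<in> carrier V \<Longrightarrow> w \<in> carrier V \<Longrightarrow> v + w \<in> carrier V"
    and smul_mem: "v \<in> carrier V \<Longrightarrow> smul V c v \<in> carrier V"
    and nrm_zero: "nrm V 0 = 0"
    and nrm_nonneg: "v \<in> carrier V \<Longrightarrow> 0 \<le> nrm V v"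
    and nrm_smul: "v \<in> carrier V \<Longrightarrow> nrm V (smul V c v) = norm c * nrm V v"
begin

lemma dual_carrier_iff:
  "f \<in> carrier (dual V) \<longleftrightarrow>
    f \<in> linear_maps V scalar_space \<and> (\<exists>C. \<forall>v\<in>carrier V. norm (f v) \<le> C * nrm V v)"
  by (simp add: dual_def bounded_operators_def scalar_space_def type_space_def)

lemma dual_nrm: "nrm (dual V) f = (SUP v\<in>unit_ball V. norm (f v))"
  by (simp add: dual_def bounded_operators_def op_norm_def scalar_space_def type_space_def)

lemma linear_maps_scalarD:
  assumes "f \<in> linear_maps V scalar_space"
  shows "v \<notin> carrier V \<Longrightarrow> f v = 0"
    and "v \<in> carrier V \<Longrightarrow> w \<in> carrier V \<Longrightarrow> f (v + w) = f v + f w"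
    and "v \<in> carrier V \<Longrightarrow> f (smul V c v) = c * f v"
  using assms by (auto simp: linear_maps_def scalar_space_def type_space_def)

lemma linear_maps_scalarI:
  assumes "\<And>v. v \<notin> carrier V \<Longrightarrow> f v = 0"
    and "\<And>v w. v \<in> carrier V \<Longrightarrow> w \<in> carrier V \<Longrightarrow> f (v + w) = f v + f w"
    and "\<And>c v. v \<in> carrier V \<Longrightarrow> f (smul V c v) = c * f v"
  shows "f \<in> linear_maps V scalar_space"
  using assms by (simp add: linear_maps_def scalar_space_def type_space_def)

lemma dual_nrm_bound:
  assumes f: "f \<in> carrier (dual V)" and v: "v \<in> carrier V"
  shows "norm (f v) \<le> nrm (dual V) f * nrm V v"
proof -
  obtain C where lin: "f \<in> linear_maps V scalar_space"
    and C: "\<And>v. v \<in> carrier V \<Longrightarrow> norm (f v) \<le> C * nrm V v"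
    using f dual_carrier_iff by auto
  show ?thesis
  proof (cases "nrm V v = 0")
    case True
    then show ?thesis using C[OF v] by simp
  next
    case False
    then have pos: "0 < nrm V v" using nrm_nonneg[OF v] by simp
    have bdd: "bdd_above ((\<lambda>v. norm (f v)) ` unit_ball V)"
    proof (rule bdd_aboveI2)
      fix w assume "w \<in> unit_ball V"
      then have w: "w \<in> carrier V" "nrm V w \<le> 1" by (auto simp: unit_ball_def)
      have "norm (f w) \<le> \<bar>C\<bar> * nrm V w"
        using C[OF w(1)] nrm_nonneg[OF w(1)] by (smt (verit) mult_right_mono)
      also have "\<dots> \<le> \<bar>C\<bar>" using w(2) by (simp add: mult_left_le)
      finally show "norm (f w) \<le> \<bar>C\<bar>" .
    qed
    define w where "w = smul V (of_real (1 / nrm V v)) v"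
    have "w \<in> unit_ball V"
      using v pos by (simp add: w_def unit_ball_def smul_mem nrm_smul norm_divide)
    then have "norm (f w) \<le> nrm (dual V) f"
      unfolding dual_nrm by (rule cSUP_upper) (rule bdd)
    moreover have "norm (f w) = norm (f v) / nrm V v"
      using v pos by (simp add: w_def linear_maps_scalarD[OF lin] norm_mult norm_divide)
    ultimately show ?thesis using pos by (simp add: field_simps)
  qed
qed

lemma dual_nrm_le:
  assumes "0 \<le> C" and C: "\<And>v. v \<in> carrier V \<Longrightarrow> norm (f v) \<le> C * nrm V v"
  shows "nrm (dual V) f \<le> C"
  unfolding dual_nrm
proof (rule cSUP_least)
  show "unit_ball V \<noteq> {}" using zero_mem nrm_zero by (force simp: unit_ball_def)
  fix w assume "w \<in> unit_ball V"
  then have w: "w \<in> carrier V" "nrm V w \<le> 1" by (auto simp: unit_ball_def)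
  show "norm (f w) \<le> C" using C[OF w(1)] w(2) \<open>0 \<le> C\<close>
    by (meson mult_left_le order_trans)
qed

text \<open>
  The dual norm, a supremum, is replaced by a pointwise bound: a functional bounded by the norm that
  takes the value \<open>nrm V v\<close> at \<open>v\<close> automatically has dual norm one.
\<close>

lemma support_functionals_iff:
  assumes v: "v \<in> carrier V" and pos: "0 < nrm V v"
  shows "f \<in> support_functionals V v \<longleftrightarrow> f \<in> linear_maps V scalar_space \<and>
    (\<forall>w\<in>carrier V. norm (f w) \<le> nrm V w) \<and> f v = of_real (nrm V v)" (is "_ \<longleftrightarrow> ?R")
proof
  assume "f \<in> support_functionals V v"
  then have f: "f \<in> carrier (dual V)" "nrm (dual V) f = 1" "f v = of_real (nrm V v)"
    by (auto simp: support_functionals_def)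
  then show ?R using dual_nrm_bound[OF f(1)] dual_carrier_iff by auto
next
  assume R: ?R
  then have f: "f \<in> carrier (dual V)"
    unfolding dual_carrier_iff by (metis mult_1)
  have "nrm (dual V) f \<le> 1" using R by (intro dual_nrm_le) auto
  moreover have "1 \<le> nrm (dual V) f"
    using dual_nrm_bound[OF f v] R pos by simp
  ultimately show "f \<in> support_functionals V v"
    using f R by (simp add: support_functionals_def)
qed

lemma linear_map_sum:
  assumes "f \<in> linear_maps V scalar_space" "finite I" "\<And>i. i \<in> I \<Longrightarrow> v i \<in> carrier V"
  shows "(\<Sum>i\<in>I. v i) \<in> carrier V \<and> f (\<Sum>i\<in>I. v i) = (\<Sum>i\<in>I. f (v i))"
  using assms(2,3)
proof (induction I)
  case empty
  have "f 0 = 0"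
    using linear_maps_scalarD(2)[OF assms(1) zero_mem zero_mem] by simp
  then show ?case by (simp add: zero_mem)
next
  case (insert j I)
  then show ?case by (simp add: add_mem linear_maps_scalarD[OF assms(1)])
qed

end

section \<open>Spaces of compact operators\<close>

text \<open>
  A second norm on a normed type, equivalent to the one of the type class. It induces the same
  topology, so compactness of operators becomes compactness in the sense of the type class. This
  covers the $\ell_p$ sum, whose vectors have the Euclidean sum as their type class norm.
\<close>

locale equivalent_norm_space = vector_space "smul W"
  for W :: "('k::real_or_complex, 'b::real_normed_vector) nspace" +
  assumes carrier_UNIV: "carrier W = UNIV"
    and nrm_smul: "nrm W (smul W c y) = norm c * nrm W y"
    and nrm_triangle: "nrm W (y + z) \<le> nrm W y + nrm W z"
    and nrm_upper: "\<exists>b>0. \<forall>y. nrm W y \<le> b * norm y"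
    and nrm_lower: "\<exists>a>0. \<forall>y. norm y \<le> a * nrm W y"
begin

lemma nrm_nonneg: "0 \<le> nrm W y"
  using nrm_lower norm_ge_zero by (metis mult_le_cancel_left_pos mult_zero_right order_trans)

lemma nrm_eq_0_iff: "nrm W y = 0 \<longleftrightarrow> y = 0"
proof
  assume "nrm W y = 0"
  then show "y = 0" using nrm_lower by (metis mult_zero_right norm_le_zero_iff)
next
  assume "y = 0"
  then show "nrm W y = 0" using nrm_upper nrm_nonneg[of y]
    by (metis antisym mult_zero_right norm_zero)
qed

lemma nrm_zero: "nrm W 0 = 0"
  by (simp add: nrm_eq_0_iff)

lemma nrm_minus: "nrm W (- y) = nrm W y"
  using nrm_smul[of "- 1" y] by simp

lemma nrm_metric: "Metric_space UNIV (\<lambda>x y. nrm W (x - y))"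
proof
  fix x y z
  show "nrm W (x - y) = nrm W (y - x)" using nrm_minus[of "x - y"] by simp
  show "nrm W (x - z) \<le> nrm W (x - y) + nrm W (y - z)"
    using nrm_triangle[of "x - y" "y - z"] by simp
qed (simp_all add: nrm_nonneg nrm_eq_0_iff)

lemma norm_topology_eq: "norm_topology W = euclidean"
proof -
  interpret M: Metric_space UNIV "\<lambda>x y. nrm W (x - y)" by (rule nrm_metric)
  obtain b where b: "b > 0" "\<And>y. nrm W y \<le> b * norm y" using nrm_upper by blast
  obtain a where a: "a > 0" "\<And>y. norm y \<le> a * nrm W y" using nrm_lower by blast
  show ?thesis
    unfolding norm_topology_def carrier_UNIV
  proof (rule topology_eq[THEN iffD2], intro allI)
    fix U :: "'b set"
    have "(\<exists>r>0. M.mball x r \<subseteq> U) \<longleftrightarrow> (\<exists>e>0. ball x e \<subseteq> U)" for x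
    proof
      assume "\<exists>r>0. M.mball x r \<subseteq> U"
      then obtain r where r: "r > 0" "M.mball x r \<subseteq> U" by blast
      have "ball x (r / b) \<subseteq> M.mball x r"
      proof
        fix y assume "y \<in> ball x (r / b)"
        then have "b * norm (x - y) < r" using b(1) by (simp add: dist_norm field_simps)
        then show "y \<in> M.mball x r" using b(2)[of "x - y"] by (simp add: M.mball_def)
      qed
      then show "\<exists>e>0. ball x e \<subseteq> U" using r b(1) by (intro exI[of _ "r / b"]) auto
    next
      assume "\<exists>e>0. ball x e \<subseteq> U"
      then obtain e where e: "e > 0" "ball x e \<subseteq> U" by blast
      have "M.mball x (e / a) \<subseteq> ball x e"
      proof
        fix y assume "y \<in> M.mball x (e / a)"
        then have "a * nrm W (x - y) < e" using a(1) by (simp add: M.mball_def field_simps)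
        then show "y \<in> ball x e" using a(2)[of "x - y"] by (simp add: dist_norm)
      qed
      then show "\<exists>r>0. M.mball x r \<subseteq> U" using e a(1) by (intro exI[of _ "e / a"]) auto
    qed
    then show "openin M.mtopology U \<longleftrightarrow> openin euclidean U"
      by (auto simp: M.openin_mtopology open_contains_ball)
  qed
qed

lemma continuous_on_smul: "continuous_on A (smul W c)"
proof -
  obtain b where b: "b > 0" "\<And>y. nrm W y \<le> b * norm y" using nrm_upper by blast
  obtain a where a: "a > 0" "\<And>y. norm y \<le> a * nrm W y" using nrm_lower by blast
  have "(a * (norm c * b))-lipschitz_on A (smul W c)"
  proof (rule lipschitz_onI)
    fix x y
    have "norm (smul W c x - smul W c y) \<le> a * nrm W (smul W c (x - y))"
      using a(2) by (simp add: scale_right_diff_distrib)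
    also have "\<dots> = a * (norm c * nrm W (x - y))" by (simp add: nrm_smul)
    also have "\<dots> \<le> a * (norm c * (b * norm (x - y)))"
      using a(1) b(2) by (intro mult_left_mono) auto
    finally show "dist (smul W c x) (smul W c y) \<le> a * (norm c * b) * dist x y"
      by (simp add: dist_norm mult.assoc)
  qed (use a b in auto)
  then show ?thesis by (rule lipschitz_on_continuous_on)
qed

end

lemma compact_closure_subset:
  fixes A C :: "'a::t2_space set"
  assumes "compact C" "A \<subseteq> C"
  shows "compact (closure A)"
proof -
  have "closure A \<subseteq> C" using assms by (simp add: closure_minimal compact_imp_closed)
  then have "closure A = C \<inter> closure A" by blast
  then show ?thesis using assms(1) by (metis closed_closure compact_Int_closed)
qed

locale compact_operator_space = dom: normed_space_over scaleX + cod: equivalent_norm_space W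
  for scaleX :: "'k::real_or_complex \<Rightarrow> 'x::real_normed_vector \<Rightarrow> 'x"
    and W :: "('k, 'b::real_normed_vector) nspace"
begin

abbreviation K where "K \<equiv> compact_operators (type_space scaleX) W"

lemma carrier_iff: "S \<in> carrier K \<longleftrightarrow> (\<forall>x y. S (x + y) = S x + S y) \<and>
    (\<forall>c x. S (scaleX c x) = smul W c (S x)) \<and> compact (closure (S ` cball 0 1))"
proof -
  have "unit_ball (type_space scaleX) = cball 0 1"
    by (auto simp: unit_ball_def type_space_def)
  then show ?thesis
    by (simp add: compact_operators_def linear_maps_def type_space_def cod.carrier_UNIV
        cod.norm_topology_eq euclidean_closure_of)
qed

lemma smul_K: "smul K c S = (\<lambda>x. smul W c (S x))"
  by (simp add: compact_operators_def)

lemma nrm_K: "nrm K S = (SUP x\<in>cball 0 1. nrm W (S x))"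
proof -
  have "unit_ball (type_space scaleX) = cball 0 1"
    by (auto simp: unit_ball_def type_space_def)
  then show ?thesis by (simp add: compact_operators_def op_norm_def)
qed

lemma
  assumes S: "S \<in> carrier K"
  shows K_add: "S (x + y) = S x + S y" and K_scale: "S (scaleX c x) = smul W c (S x)"
    and K_compact: "compact (closure (S ` cball 0 1))" and K_zero: "S 0 = 0"
proof -
  show add: "S (x + y) = S x + S y" and "S (scaleX c x) = smul W c (S x)"
    and "compact (closure (S ` cball 0 1))" for x y
    using S carrier_iff by blast+
  show "S 0 = 0" using add[of 0 0] by simp
qed

lemma nrm_le_nrm_K:
  assumes S: "S \<in> carrier K"
  shows "nrm W (S x) \<le> nrm K S * norm x"
proof (cases "x = 0")
  case True
  then show ?thesis by (simp add: K_zero[OF S] cod.nrm_zero)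
next
  case False
  obtain b where b: "b > 0" "\<And>y. nrm W y \<le> b * norm y" using cod.nrm_upper by blast
  have "bounded (S ` cball 0 1)"
    using compact_imp_bounded[OF K_compact[OF S]] bounded_subset closure_subset by blast
  then obtain B where B: "\<And>x. x \<in> cball 0 1 \<Longrightarrow> norm (S x) \<le> B"
    unfolding bounded_iff by blast
  have bdd: "bdd_above ((\<lambda>x. nrm W (S x)) ` cball 0 1)"
  proof (rule bdd_aboveI2)
    fix x :: 'x assume "x \<in> cball 0 1"
    then have "b * norm (S x) \<le> b * B" using B b(1) by (simp del: mem_cball)
    then show "nrm W (S x) \<le> b * B" using b(2)[of "S x"] by linarith
  qed
  define y where "y = scaleX (of_real (1 / norm x)) x"
  have "y \<in> cball 0 1"
    using False unfolding y_def dom.scale_of_real by simp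
  then have "nrm W (S y) \<le> nrm K S"
    unfolding nrm_K by (rule cSUP_upper) (rule bdd)
  moreover have "nrm W (S y) = nrm W (S x) / norm x"
    by (simp add: y_def K_scale[OF S] cod.nrm_smul norm_divide)
  ultimately show ?thesis using False by (simp add: field_simps)
qed

lemma nrm_K_le:
  assumes "0 \<le> C" "\<And>x. nrm W (S x) \<le> C * norm x"
  shows "nrm K S \<le> C"
  unfolding nrm_K
proof (rule cSUP_least)
  fix x :: 'x assume "x \<in> cball 0 1"
  then have "C * norm x \<le> C" using assms(1) by (simp add: mult_left_le)
  then show "nrm W (S x) \<le> C" using assms(2)[of x] by linarith
qed simp

lemma nrm_K_nonneg: "S \<in> carrier K \<Longrightarrow> 0 \<le> nrm K S"
proof -
  assume S: "S \<in> carrier K"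
  have "nrm W (S 0) \<le> nrm K S"
    unfolding nrm_K
  proof (rule cSUP_upper2)
    show "bdd_above ((\<lambda>x. nrm W (S x)) ` cball 0 1)"
    proof (rule bdd_aboveI2)
      fix x :: 'x assume x: "x \<in> cball 0 1"
      have "nrm W (S x) \<le> nrm K S * norm x" by (rule nrm_le_nrm_K[OF S])
      also have "\<dots> \<le> \<bar>nrm K S\<bar> * 1" using x by (intro mult_mono) auto
      finally show "nrm W (S x) \<le> \<bar>nrm K S\<bar>" by simp
    qed
  qed auto
  then show "0 \<le> nrm K S" using cod.nrm_nonneg[of "S 0"] by linarith
qed

lemma nrm_K_triangle:
  assumes S: "S \<in> carrier K" and R: "R \<in> carrier K"
  shows "nrm K (S + R) \<le> nrm K S + nrm K R"
proof (rule nrm_K_le)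
  fix x
  have "nrm W ((S + R) x) \<le> nrm W (S x) + nrm W (R x)" by (simp add: cod.nrm_triangle)
  also have "\<dots> \<le> nrm K S * norm x + nrm K R * norm x"
    by (intro add_mono nrm_le_nrm_K S R)
  finally show "nrm W ((S + R) x) \<le> (nrm K S + nrm K R) * norm x"
    by (simp add: distrib_right)
qed (simp add: nrm_K_nonneg S R)

lemma nrm_K_pos:
  assumes S: "S \<in> carrier K" and "S \<noteq> 0"
  shows "0 < nrm K S"
proof (rule ccontr)
  assume "\<not> 0 < nrm K S"
  then have "nrm K S = 0" using nrm_K_nonneg[OF S] by simp
  then have "nrm W (S x) = 0" for x
    using nrm_le_nrm_K[OF S, of x] cod.nrm_nonneg[of "S x"] by simp
  then show False using \<open>S \<noteq> 0\<close> by (auto simp: cod.nrm_eq_0_iff fun_eq_iff)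
qed

lemma K_smul_mem:
  assumes S: "S \<in> carrier K"
  shows "smul K c S \<in> carrier K"
  unfolding carrier_iff smul_K
proof (intro conjI allI)
  have "compact (smul W c ` closure (S ` cball 0 1))"
    using cod.continuous_on_smul K_compact[OF S] by (rule compact_continuous_image)
  moreover have "(\<lambda>x. smul W c (S x)) ` cball 0 1 \<subseteq> smul W c ` closure (S ` cball 0 1)"
    using closure_subset by fastforce
  ultimately show "compact (closure ((\<lambda>x. smul W c (S x)) ` cball 0 1))"
    by (rule compact_closure_subset)
qed (simp_all add: K_add[OF S] K_scale[OF S] cod.scale_right_distrib mult.commute)

lemma K_add_mem:
  assumes S: "S \<in> carrier K" and R: "R \<in> carrier K"
  shows "S + R \<in> carrier K"
  unfolding carrier_iff
proof (intro conjI allI)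
  have "compact {y + z |y z. y \<in> closure (S ` cball 0 1) \<and> z \<in> closure (R ` cball 0 1)}"
    using K_compact[OF S] K_compact[OF R] by (rule compact_sums)
  moreover have "(S + R) x \<in> {y + z |y z. y \<in> closure (S ` cball 0 1) \<and> z \<in> closure (R ` cball 0 1)}"
    if "x \<in> cball 0 1" for x
  proof -
    have "S x \<in> closure (S ` cball 0 1)" "R x \<in> closure (R ` cball 0 1)"
      using that by (auto intro!: closure_subset[THEN subsetD])
    then show ?thesis by auto
  qed
  ultimately show "compact (closure ((S + R) ` cball 0 1))"
    by (intro compact_closure_subset image_subsetI)
qed (simp_all add: K_add[OF S] K_scale[OF S] K_add[OF R] K_scale[OF R] cod.scale_right_distrib)

sublocale K: normed_nspace K
proof
  show zero: "0 \<in> carrier K"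
    by (simp add: carrier_iff cod.scale_zero_right image_constant_conv)
  show "nrm K 0 = 0"
    using nrm_K_le[of 0 0] nrm_K_nonneg[OF zero] by (simp add: cod.nrm_zero)
  show "nrm K (smul K c S) = norm c * nrm K S" if S: "S \<in> carrier K" for S c
  proof (rule antisym)
    have le: "nrm K (smul K c S) \<le> norm c * nrm K S" if S: "S \<in> carrier K" for S c
    proof (rule nrm_K_le)
      show "nrm W (smul K c S x) \<le> norm c * nrm K S * norm x" for x
        using nrm_le_nrm_K[OF S, of x] by (simp add: smul_K cod.nrm_smul mult_left_mono mult.assoc)
    qed (simp add: nrm_K_nonneg[OF S])
    show "nrm K (smul K c S) \<le> norm c * nrm K S" by (rule le[OF S])
    show "norm c * nrm K S \<le> nrm K (smul K c S)"
    proof (cases "c = 0")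
      case True
      then show ?thesis using nrm_K_nonneg[OF K_smul_mem[OF S]] by simp
    next
      case False
      have "smul K (1 / c) (smul K c S) = S" using False by (simp add: smul_K)
      then show ?thesis
        using le[OF K_smul_mem[OF S], of "1 / c" c] False by (simp add: norm_divide field_simps)
    qed
  qed
qed (fact K_add_mem K_smul_mem nrm_K_nonneg)+

end

text \<open>
  Post-composition with a continuous linear map is how operators move between the summand and the
  sum.
\<close>

lemma compact_operator_compose:
  assumes "compact_operator_space scaleX W" "compact_operator_space scaleX W'"
    and S: "S \<in> carrier (compact_operators (type_space scaleX) W)"
    and L: "\<And>y z. L (y + z) = L y + L z" "\<And>c y. L (smul W c y) = smul W' c (L y)" "continuous_on UNIV L"
  shows "(\<lambda>x. L (S x)) \<in> carrier (compact_operators (type_space scaleX) W')"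
proof -
  interpret A: compact_operator_space scaleX W by fact
  interpret B: compact_operator_space scaleX W' by fact
  have "compact (L ` closure (S ` cball 0 1))"
    using continuous_on_subset[OF L(3)] A.K_compact[OF S] by (intro compact_continuous_image) auto
  moreover have "(\<lambda>x. L (S x)) ` cball 0 1 \<subseteq> L ` closure (S ` cball 0 1)"
    using closure_subset by fastforce
  ultimately have "compact (closure ((\<lambda>x. L (S x)) ` cball 0 1))"
    by (rule compact_closure_subset)
  then show ?thesis
    by (simp add: B.carrier_iff A.K_add[OF S] A.K_scale[OF S] L)
qed

section \<open>The $\ell_p$ sum as an equivalent norm on the product\<close>

lemma equivalent_norm_space_type_space:
  assumes "normed_space_over (s :: 'k::real_or_complex \<Rightarrow> 'b::real_normed_vector \<Rightarrow> 'b)"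
  shows "equivalent_norm_space (type_space s)"
proof -
  interpret normed_space_over s by fact
  show ?thesis
  proof
    show "\<exists>b>0. \<forall>y. nrm (type_space s) y \<le> b * norm y"
      "\<exists>a>0. \<forall>y. norm y \<le> a * nrm (type_space s) y"
      by (intro exI[of _ 1]; simp add: type_space_def)+
  qed (simp_all add: type_space_def norm_scale norm_triangle_ineq scale_right_distrib scale_left_distrib)
qed

lemma smul_type_space: "smul (type_space s) = s"
  and nrm_type_space: "nrm (type_space s) = norm"
  by (simp_all add: type_space_def)

lemma nrm_lp_sum: "nrm (lp_sum p (type_space s)) y = lp_norm p (\<lambda>i. norm (y $ i))"
  by (simp add: lp_sum_def lp_norm_def type_space_def)

lemma smul_lp_sum: "smul (lp_sum p (type_space s)) c y = (\<chi> i. s c (y $ i))"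
  by (simp add: lp_sum_def type_space_def)

lemma equivalent_norm_space_lp_sum:
  fixes s :: "'k::real_or_complex \<Rightarrow> 'b::real_normed_vector \<Rightarrow> 'b"
  assumes "normed_space_over s" and p: "1 \<le> p"
  shows "equivalent_norm_space (lp_sum p (type_space s) :: ('k, 'b ^ 'd::finite) nspace)"
    (is "equivalent_norm_space ?W")
proof -
  interpret normed_space_over s by fact
  show ?thesis
  proof
    fix c y z
    show "nrm ?W (smul ?W c y) = norm c * nrm ?W y"
      using lp_norm_scale[OF p, of "norm c" "\<lambda>i. norm (y $ i)"]
      by (simp add: nrm_lp_sum smul_lp_sum norm_scale)
    have "nrm ?W (y + z) \<le> lp_norm p (\<lambda>i. norm (y $ i) + norm (z $ i))"
      unfolding nrm_lp_sum using p by (intro lp_norm_mono) (auto simp: norm_triangle_ineq)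
    also have "\<dots> \<le> nrm ?W y + nrm ?W z"
      unfolding nrm_lp_sum using p by (intro lp_norm_triangle) auto
    finally show "nrm ?W (y + z) \<le> nrm ?W y + nrm ?W z" .
  next
    have "nrm ?W y \<le> lp_norm p (\<lambda>i::'d. 1) * norm y" for y
    proof -
      have "nrm ?W y \<le> lp_norm p (\<lambda>i::'d. norm y * 1)"
        unfolding nrm_lp_sum using p by (intro lp_norm_mono) (auto simp: Finite_Cartesian_Product.norm_nth_le)
      also have "\<dots> = norm y * lp_norm p (\<lambda>i::'d. 1)"
        using p by (intro lp_norm_scale) auto
      finally show ?thesis by (simp add: mult.commute)
    qed
    moreover have "0 < lp_norm p (\<lambda>i::'d. 1)" using p by (intro lp_norm_pos) auto
    ultimately show "\<exists>b>0. \<forall>y. nrm ?W y \<le> b * norm y" by blast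
  next
    have "norm y \<le> real CARD('d) * nrm ?W y" for y
    proof -
      have "norm y \<le> (\<Sum>i\<in>UNIV. norm (y $ i))"
        unfolding norm_vec_def by (rule L2_set_le_sum) simp
      also have "\<dots> \<le> real CARD('d) * nrm ?W y"
        unfolding nrm_lp_sum
        using component_le_lp_norm[OF p, of "\<lambda>i. norm (y $ i)"] by (intro sum_bounded_above) auto
      finally show ?thesis .
    qed
    then show "\<exists>a>0. \<forall>y. norm y \<le> a * nrm ?W y" by (intro exI[of _ "real CARD('d)"]) auto
  next
    show "carrier ?W = UNIV" by (simp add: lp_sum_def type_space_def)
  qed (simp_all add: smul_lp_sum vec_eq_iff scale_right_distrib scale_left_distrib)
qed

section \<open>Operators into an $\ell_p$ sum\<close>

lemma sum_fun_apply: "(\<Sum>i\<in>I. f i) x = (\<Sum>i\<in>I. f i x)"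
  by (induction I rule: infinite_finite_induct) auto

text \<open>
  The parameter \<open>index\<close> only fixes the index type, which occurs in none of the other
  parameters.
\<close>

locale lp_operators = X: normed_space_over scaleX + Y: normed_space_over scaleY
  for scaleX :: "'k::real_or_complex \<Rightarrow> 'x::real_normed_vector \<Rightarrow> 'x"
    and scaleY :: "'k \<Rightarrow> 'y::real_normed_vector \<Rightarrow> 'y" +
  fixes p :: real and index :: "'d::finite itself"
  assumes p: "1 \<le> p"
begin

abbreviation LP :: "('k, 'y ^ 'd) nspace" where "LP \<equiv> lp_sum p (type_space scaleY)"

sublocale KY: compact_operator_space scaleX "type_space scaleY"
  by (simp add: compact_operator_space_def X.normed_space_over_axioms
      equivalent_norm_space_type_space Y.normed_space_over_axioms)

sublocale KP: compact_operator_space scaleX LP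
  by (simp add: compact_operator_space_def X.normed_space_over_axioms
      equivalent_norm_space_lp_sum Y.normed_space_over_axioms p)

definition component :: "'d \<Rightarrow> ('x \<Rightarrow> 'y ^ 'd) \<Rightarrow> 'x \<Rightarrow> 'y"
  where "component i S = (\<lambda>x. S x $ i)"

definition inject :: "'d \<Rightarrow> ('x \<Rightarrow> 'y) \<Rightarrow> 'x \<Rightarrow> 'y ^ 'd"
  where "inject i S = (\<lambda>x. axis i (S x))"

lemma component_mem:
  assumes "S \<in> carrier KP.K"
  shows "component i S \<in> carrier KY.K"
  unfolding component_def
proof (rule compact_operator_compose[OF KP.compact_operator_space_axioms
      KY.compact_operator_space_axioms assms, where L = "\<lambda>y. y $ i"])
qed (simp_all add: smul_lp_sum smul_type_space continuous_on_component continuous_on_id)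

lemma inject_mem:
  assumes "S \<in> carrier KY.K"
  shows "inject i S \<in> carrier KP.K"
  unfolding inject_def
proof (rule compact_operator_compose[OF KY.compact_operator_space_axioms
      KP.compact_operator_space_axioms assms, where L = "axis i"])
  have "linear (axis i :: 'y \<Rightarrow> 'y ^ 'd)"
    by (rule linearI) (simp_all add: axis_def vec_eq_iff)
  moreover have "norm (axis i y) \<le> norm y * 1" for y :: 'y
    using L2_set_le_sum[of UNIV "\<lambda>j. norm (axis i y $ j)"]
    by (simp add: norm_vec_def axis_def if_distrib[of norm] cong: if_cong)
  ultimately have "bounded_linear (axis i :: 'y \<Rightarrow> 'y ^ 'd)"
    unfolding bounded_linear_def bounded_linear_axioms_def by blast
  then show "continuous_on UNIV (axis i :: 'y \<Rightarrow> 'y ^ 'd)"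
    by (rule linear_continuous_on)
qed (simp_all add: smul_lp_sum smul_type_space axis_def vec_eq_iff)

lemma inject_add: "inject i (S + R) = inject i S + inject i R"
  by (auto simp: inject_def axis_def vec_eq_iff)

lemma inject_smul: "inject i (smul KY.K c S) = smul KP.K c (inject i S)"
  by (auto simp: inject_def KY.smul_K KP.smul_K smul_lp_sum smul_type_space axis_def vec_eq_iff)

lemma component_apply: "component i S x = S x $ i"
  by (simp add: component_def)

lemma component_add: "component i (S + R) = component i S + component i R"
  by (auto simp: component_def)

lemma component_smul: "component i (smul KP.K c S) = smul KY.K c (component i S)"
  by (auto simp: component_def KY.smul_K KP.smul_K smul_lp_sum smul_type_space)

lemma component_inject: "component j (inject i S) = (if j = i then S else 0)"
  by (auto simp: component_def inject_def axis_def)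

lemma sum_inject_component: "(\<Sum>i\<in>UNIV. inject i (component i S)) = S"
  by (auto simp: fun_eq_iff vec_eq_iff sum_fun_apply inject_def component_def axis_def)

text \<open>
  In general this is strict, since the components need not come close to their norms at the same
  vector.
\<close>

lemma nrm_KP_le:
  assumes S: "S \<in> carrier KP.K"
  shows "nrm KP.K S \<le> lp_norm p (\<lambda>i. nrm KY.K (component i S))"
proof (rule KP.nrm_K_le)
  fix x
  have "norm (S x $ i) \<le> norm x * nrm KY.K (component i S)" for i
    using KY.nrm_le_nrm_K[OF component_mem[OF S], of i x]
    by (simp add: nrm_type_space component_apply mult.commute)
  then have "nrm LP (S x) \<le> lp_norm p (\<lambda>i. norm x * nrm KY.K (component i S))"
    unfolding nrm_lp_sum using p by (intro lp_norm_mono) auto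
  also have "\<dots> = norm x * lp_norm p (\<lambda>i. nrm KY.K (component i S))"
    using p KY.nrm_K_nonneg[OF component_mem[OF S]] by (intro lp_norm_scale) auto
  finally show "nrm LP (S x) \<le> lp_norm p (\<lambda>i. nrm KY.K (component i S)) * norm x"
    by (simp add: mult.commute)
qed (rule lp_norm_nonneg)

text \<open>
  First variation of the norm at \<open>T\<close> in the direction of a rotation of \<open>inject i S\<close> that makes the
  value of \<open>F\<close> nonnegative: \<open>F\<close> grows with slope \<open>norm (F (inject i S))\<close>, while the norm, which
  dominates \<open>F\<close> and starts at the same value, grows with slope at most
  \<open>lp_dual p n i * nrm S\<close>.
\<close>

lemma contraction_on_summand:
  assumes T: "T \<in> carrier KP.K" and n: "\<And>i. 0 < nrm KY.K (component i T)"
    and F: "F \<in> linear_maps KP.K scalar_space"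
    and F1: "\<And>S. S \<in> carrier KP.K \<Longrightarrow> norm (F S) \<le> nrm KP.K S"
    and FT: "F T = of_real (lp_norm p (\<lambda>i. nrm KY.K (component i T)))"
    and S: "S \<in> carrier KY.K"
  shows "norm (F (inject i S)) \<le> lp_dual p (\<lambda>i. nrm KY.K (component i T)) i * nrm KY.K S"
proof (rule slope_le_lp_dual[OF p n])
  fix t :: real assume t: "0 < t"
  let ?n = "\<lambda>i. nrm KY.K (component i T)"
  obtain u where u: "norm u = 1" "u * F (inject i S) = of_real (norm (F (inject i S)))"
    by (rule unit_multiple_is_norm)
  define c where "c = of_real t * u"
  have c: "norm c = t" using u(1) t by (simp add: c_def norm_mult)
  have cS: "smul KY.K c S \<in> carrier KY.K" by (rule KY.K_smul_mem[OF S])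
  define R where "R = T + smul KP.K c (inject i S)"
  have R: "R \<in> carrier KP.K"
    unfolding R_def by (intro KP.K_add_mem KP.K_smul_mem inject_mem T S)
  have "F R = F T + c * F (inject i S)"
    unfolding R_def
    by (simp add: KP.K.linear_maps_scalarD[OF F] T inject_mem[OF S] KP.K_smul_mem)
  also have "\<dots> = of_real (lp_norm p ?n + t * norm (F (inject i S)))"
    using u(2) by (simp add: FT c_def mult.assoc)
  finally have "lp_norm p ?n + t * norm (F (inject i S)) \<le> norm (F R)"
    by (metis abs_ge_self norm_of_real)
  also have "\<dots> \<le> lp_norm p (\<lambda>j. nrm KY.K (component j R))"
    using F1[OF R] nrm_KP_le[OF R] by linarith
  also have "\<dots> \<le> lp_norm p (?n(i := ?n i + t * nrm KY.K S))"
  proof (rule lp_norm_mono[OF p])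
    fix j
    show "0 \<le> nrm KY.K (component j R)" by (rule KY.nrm_K_nonneg[OF component_mem[OF R]])
    show "nrm KY.K (component j R) \<le> (?n(i := ?n i + t * nrm KY.K S)) j"
    proof (cases "j = i")
      case True
      have "component i R = component i T + smul KY.K c S"
        by (simp add: R_def component_add component_smul component_inject)
      then show ?thesis
        using True KY.nrm_K_triangle[OF component_mem[OF T] cS, of i] c
        by (simp add: KY.K.nrm_smul[OF S])
    next
      case False
      have "smul KY.K c 0 = 0" by (auto simp: KY.smul_K smul_type_space)
      then show ?thesis
        using False by (simp add: R_def component_add component_smul component_inject)
    qed
  qed
  finally show "lp_norm p ?n + t * norm (F (inject i S)) \<le> lp_norm p (?n(i := ?n i + t * nrm KY.K S))" .
qed

text \<open>
  The restriction of \<open>F\<close> to the \<open>i\<close>-th summand is bounded by \<open>c i\<close>. The values at the components of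
  \<open>T\<close> add up to the sum of the bounds \<open>c i * n i\<close> by \<open>sum_lp_dual_self\<close>, so each bound is
  attained.
\<close>

lemma support_functional_restricts:
  assumes T: "T \<in> carrier KP.K" and n: "\<And>i. 0 < nrm KY.K (component i T)"
    and F: "F \<in> linear_maps KP.K scalar_space"
    and F1: "\<And>S. S \<in> carrier KP.K \<Longrightarrow> norm (F S) \<le> nrm KP.K S"
    and FT: "F T = of_real (lp_norm p (\<lambda>i. nrm KY.K (component i T)))"
  defines "c \<equiv> lp_dual p (\<lambda>i. nrm KY.K (component i T))"
  shows "(\<lambda>S. F (inject i S) / of_real (c i)) \<in> support_functionals KY.K (component i T)"
proof -
  let ?n = "\<lambda>i. nrm KY.K (component i T)"
  have N: "0 < lp_norm p ?n" by (rule lp_norm_pos[OF p less_imp_le[OF n] n])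
  have c: "0 < c i" using n[of i] N by (simp add: c_def lp_dual_def)
  have bound: "norm (F (inject j S)) \<le> c j * nrm KY.K S" if "S \<in> carrier KY.K" for j S
    unfolding c_def by (rule contraction_on_summand[OF T n F F1 FT that])
  have off: "F (inject i S) = 0" if "S \<notin> carrier KY.K" for S
  proof -
    have "inject i S \<notin> carrier KP.K"
      using component_mem[of "inject i S" i] that by (auto simp: component_inject)
    then show ?thesis by (rule KP.K.linear_maps_scalarD(1)[OF F])
  qed
  have "F T = (\<Sum>j\<in>UNIV. F (inject j (component j T)))"
    using KP.K.linear_map_sum[OF F, of UNIV "\<lambda>j. inject j (component j T)"]
      inject_mem[OF component_mem[OF T]] by (simp add: sum_inject_component)
  then have "(\<Sum>j\<in>UNIV. F (inject j (component j T))) = of_real (\<Sum>j\<in>UNIV. c j * ?n j)"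
    using sum_lp_dual_self[OF p less_imp_le[OF n] N] FT by (simp add: c_def)
  then have val: "F (inject i (component i T)) = of_real (c i * ?n i)"
    using bound[OF component_mem[OF T]]
    by (intro sum_eq_sum_bounds_imp_eq[where I = UNIV
          and z = "\<lambda>j. F (inject j (component j T))" and r = "\<lambda>j. c j * ?n j" and i = i])
      simp_all
  show ?thesis
    unfolding KY.K.support_functionals_iff[OF component_mem[OF T] n]
  proof (intro conjI ballI)
    show "(\<lambda>S. F (inject i S) / of_real (c i)) \<in> linear_maps KY.K scalar_space"
    proof (rule KY.K.linear_maps_scalarI)
      fix S R k
      assume S: "S \<in> carrier KY.K"
      show "F (inject i (smul KY.K k S)) / of_real (c i) = k * (F (inject i S) / of_real (c i))"
        by (simp only: inject_smul KP.K.linear_maps_scalarD(3)[OF F inject_mem[OF S]] times_divide_eq_right)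
      assume R: "R \<in> carrier KY.K"
      show "F (inject i (S + R)) / of_real (c i)
          = F (inject i S) / of_real (c i) + F (inject i R) / of_real (c i)"
        by (simp only: inject_add KP.K.linear_maps_scalarD(2)[OF F inject_mem[OF S] inject_mem[OF R]]
            add_divide_distrib)
    qed (simp add: off)
    show "norm (F (inject i S) / of_real (c i)) \<le> nrm KY.K S" if "S \<in> carrier KY.K" for S
      using bound[OF that] c by (simp add: norm_divide field_simps)
    show "F (inject i (component i T)) / of_real (c i) = of_real (?n i)"
      using val c by simp
  qed
qed

lemma support_functional_unique:
  assumes T: "T \<in> carrier KP.K" and smooth: "\<And>i. smooth KY.K (component i T)"
    and n: "\<And>i. 0 < nrm KY.K (component i T)"
    and F: "F \<in> linear_maps KP.K scalar_space" "\<And>S. S \<in> carrier KP.K \<Longrightarrow> norm (F S) \<le> nrm KP.K S"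
      "F T = of_real (lp_norm p (\<lambda>i. nrm KY.K (component i T)))"
    and G: "G \<in> linear_maps KP.K scalar_space" "\<And>S. S \<in> carrier KP.K \<Longrightarrow> norm (G S) \<le> nrm KP.K S"
      "G T = of_real (lp_norm p (\<lambda>i. nrm KY.K (component i T)))"
  shows "F = G"
proof
  fix S
  let ?n = "\<lambda>i. nrm KY.K (component i T)"
  have N: "0 < lp_norm p ?n" by (rule lp_norm_pos[OF p less_imp_le[OF n] n])
  have c: "lp_dual p ?n i \<noteq> 0" for i using n[of i] N by (simp add: lp_dual_def)
  have "(\<lambda>S. F (inject i S) / of_real (lp_dual p ?n i))
      = (\<lambda>S. G (inject i S) / of_real (lp_dual p ?n i))" for i
    using smooth[of i] support_functional_restricts[OF T n F, of i]
      support_functional_restricts[OF T n G, of i]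
    unfolding smooth_def is_singleton_def by force
  then have eq: "F (inject i R) = G (inject i R)" for i R
    using c[of i] by (metis (no_types, lifting) nonzero_divide_eq_eq nonzero_eq_divide_eq of_real_eq_0_iff)
  show "F S = G S"
  proof (cases "S \<in> carrier KP.K")
    case True
    then have "inject i (component i S) \<in> carrier KP.K" for i by (intro inject_mem component_mem)
    then show ?thesis
      using KP.K.linear_map_sum[OF F(1), of UNIV "\<lambda>i. inject i (component i S)"]
        KP.K.linear_map_sum[OF G(1), of UNIV "\<lambda>i. inject i (component i S)"]
      by (simp add: sum_inject_component eq)
  next
    case False
    then show ?thesis
      using KP.K.linear_maps_scalarD(1)[OF F(1)] KP.K.linear_maps_scalarD(1)[OF G(1)] by simp
  qed
qed

text \<open>
  A common norming vector turns the bound \<open>nrm_KP_le\<close> into an equality.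
\<close>

lemma nrm_KP_eq:
  assumes T: "T \<in> carrier KP.K" and x: "norm x = 1"
    and att: "\<And>i. norm (component i T x) = nrm KY.K (component i T)"
  shows "nrm KP.K T = lp_norm p (\<lambda>i. nrm KY.K (component i T))"
proof (rule antisym[OF nrm_KP_le[OF T]])
  have "lp_norm p (\<lambda>i. nrm KY.K (component i T)) = nrm LP (T x)"
    by (simp only: nrm_lp_sum component_apply flip: att)
  also have "\<dots> \<le> nrm KP.K T" using KP.nrm_le_nrm_K[OF T, of x] x by simp
  finally show "lp_norm p (\<lambda>i. nrm KY.K (component i T)) \<le> nrm KP.K T" .
qed

text \<open>
  Evaluation at the common norming vector \<open>x\<close>, followed by the functional on the $\ell_p$ sum with
  components \<open>lp_dual p n i * g i\<close>, where \<open>g i\<close> norms \<open>T x $ i\<close>.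
\<close>

lemma support_functional_exists:
  assumes T: "T \<in> carrier KP.K" and n: "\<And>i. 0 < nrm KY.K (component i T)" and x: "norm x = 1"
    and att: "\<And>i. norm (component i T x) = nrm KY.K (component i T)"
  shows "support_functionals KP.K T \<noteq> {}"
proof -
  let ?n = "\<lambda>i. nrm KY.K (component i T)"
  have N: "0 < lp_norm p ?n" by (rule lp_norm_pos[OF p less_imp_le[OF n] n])
  have nT: "nrm KP.K T = lp_norm p ?n" by (rule nrm_KP_eq[OF T x att])
  have c: "0 \<le> lp_dual p ?n i" for i by (simp add: lp_dual_def)
  have "\<exists>g. (\<forall>y z. g (y + z) = g y + g z) \<and> (\<forall>c y. g (scaleY c y) = c * g y) \<and>
      (\<forall>y. norm (g y) \<le> norm y) \<and> g (T x $ i) = of_real (norm (T x $ i))" for i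
    by (rule Y.norming_functional[of "T x $ i"]) blast
  then obtain g where g: "\<forall>i. (\<forall>y z. g i (y + z) = g i y + g i z) \<and>
      (\<forall>c y. g i (scaleY c y) = c * g i y) \<and>
      (\<forall>y. norm (g i y) \<le> norm y) \<and> g i (T x $ i) = of_real (norm (T x $ i))"
    using choice[of "\<lambda>i g. (\<forall>y z. g (y + z) = g y + g z) \<and> (\<forall>c y. g (scaleY c y) = c * g y) \<and>
      (\<forall>y. norm (g y) \<le> norm y) \<and> g (T x $ i) = of_real (norm (T x $ i))"] by blast
  have g_add: "g i (y + z) = g i y + g i z" and g_scale: "g i (scaleY c y) = c * g i y"
    and g_le: "norm (g i y) \<le> norm y" and g_att: "g i (T x $ i) = of_real (norm (T x $ i))"
    for i y z c
    using g by blast+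
  define F where "F S = (if S \<in> carrier KP.K
    then \<Sum>i\<in>UNIV. of_real (lp_dual p ?n i) * g i (S x $ i) else 0)" for S
  have "F \<in> support_functionals KP.K T"
    unfolding KP.K.support_functionals_iff[OF T N[folded nT]]
  proof (intro conjI ballI)
    show "F \<in> linear_maps KP.K scalar_space"
    proof (rule KP.K.linear_maps_scalarI)
      fix S R k
      assume S: "S \<in> carrier KP.K"
      then show "F (smul KP.K k S) = k * F S"
        using KP.K_smul_mem[OF S, of k]
        by (simp add: F_def KP.smul_K smul_lp_sum g_scale sum_distrib_left mult.left_commute)
      assume R: "R \<in> carrier KP.K"
      then show "F (S + R) = F S + F R"
        using S KP.K_add_mem[OF S R] by (simp add: F_def g_add distrib_left sum.distrib)
    qed (simp add: F_def)
    fix S assume S: "S \<in> carrier KP.K"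
    have "norm (F S) \<le> (\<Sum>i\<in>UNIV. lp_dual p ?n i * norm (S x $ i))"
      unfolding F_def using S c g_le
      by (auto intro!: sum_norm_le simp: norm_mult mult_left_mono)
    also have "\<dots> \<le> lp_norm p (\<lambda>i. norm (S x $ i))"
      by (rule sum_lp_dual_le[OF p less_imp_le[OF n] N]) simp
    also have "\<dots> = nrm LP (S x)" by (simp add: nrm_lp_sum)
    also have "\<dots> \<le> nrm KP.K S" using KP.nrm_le_nrm_K[OF S, of x] x by simp
    finally show "norm (F S) \<le> nrm KP.K S" .
  next
    have "F T = of_real (\<Sum>i\<in>UNIV. lp_dual p ?n i * ?n i)"
      using T by (simp add: F_def g_att component_apply flip: att)
    then show "F T = of_real (nrm KP.K T)"
      by (simp only: nT sum_lp_dual_self[OF p less_imp_le[OF n] N])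
  qed
  then show ?thesis by blast
qed

theorem smooth_if_components_smooth:
  assumes T: "T \<in> carrier KP.K" and smooth: "\<And>i. smooth KY.K (component i T)" and x: "norm x = 1"
    and att: "\<And>i. norm (component i T x) = nrm KY.K (component i T)"
  shows "smooth KP.K T"
proof -
  have n: "0 < nrm KY.K (component i T)" for i
    using smooth[of i] KY.nrm_K_pos unfolding smooth_def by blast
  have nT: "nrm KP.K T = lp_norm p (\<lambda>i. nrm KY.K (component i T))" by (rule nrm_KP_eq[OF T x att])
  then have pos: "0 < nrm KP.K T" using lp_norm_pos[OF p less_imp_le[OF n] n] by simp
  have "F = G" if "F \<in> support_functionals KP.K T" "G \<in> support_functionals KP.K T" for F G
    using that unfolding KP.K.support_functionals_iff[OF T pos] nT
    by (intro support_functional_unique[OF T smooth n]) auto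
  then have "is_singleton (support_functionals KP.K T)"
    using support_functional_exists[OF T n x att] by (auto intro!: is_singletonI')
  moreover have "T \<noteq> 0" using pos KP.K.nrm_zero by auto
  ultimately show ?thesis using T by (simp add: smooth_def)
qed

end

section \<open>Smoothness of operator tuples\<close>

theorem corollary2p6:
  fixes scaleX :: "'k::real_or_complex \<Rightarrow> 'x::banach \<Rightarrow> 'x"
    and scaleY :: "'k \<Rightarrow> 'y::banach \<Rightarrow> 'y"
    and X :: "('k, 'x) nspace"
    and Y :: "('k, 'y) nspace"
    and T :: "'d::finite \<Rightarrow> 'x \<Rightarrow> 'y"
    and p :: real
  assumes "normed_space_over scaleX" and "X = type_space scaleX"
    and "normed_space_over scaleY" and "Y = type_space scaleY"
    and "1 \<le> p"
    and "reflexive X"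
    and "operator_tuple T \<in> carrier (compact_operators X (lp_sum p Y))"
    and "(\<Inter>i. norm_attainment_set X Y (T i)) \<noteq> {}"
    and "\<And>i. smooth (compact_operators X Y) (T i)"
  shows "smooth (compact_operators X (lp_sum p Y)) (operator_tuple T)"
proof -
  interpret lp_operators scaleX scaleY p "TYPE('d)"
    using assms(1,3,5) by (simp add: lp_operators_def lp_operators_axioms_def)
  obtain x where x: "\<And>i. x \<in> norm_attainment_set X Y (T i)" using assms(8) by blast
  have T: "component i (operator_tuple T) = T i" for i
    by (simp add: component_def operator_tuple_def)
  have "norm x = 1" and "norm (T i x) = nrm KY.K (T i)" for i
    using x[of i] assms(2,4)
    by (auto simp: norm_attainment_set_def unit_sphere_def type_space_def compact_operators_def)
  then show ?thesis
    unfolding assms(2,4)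
    using assms(7,9) by (intro smooth_if_components_smooth[of _ x]) (simp_all add: T assms(2,4))
qed

end
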